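(* Let $m,n$ be positive integers and let $(S,T)$ be a pair of random variables on a common probability space taking values in $\{0,1,\dots,m\}\times\{0,1,\dots,n\}$. For integers $0\le k\le m$ and $0\le l\le n$ let $$F_{k,l}=\frac{\binom{m}{k}\binom{n}{l}-\overline{S}_{k,l}}{\binom{m}{k}\binom{n}{l}}$$ be Fréchet's bivariate lower bound for $P(S\ge1,T\ge1)$. Then $F_{k,l}$ is non-decreasing and concave in each of $k$ and $l$ separately, that is: (1) for each $0\le l\le n$: $F_{k,l}\le F_{k+1,l}$ for $0\le k\le m-1$, and $F_{k,l}-F_{k+1,l}\le F_{k+1,l}-F_{k+2,l}$ for $0\le k\le m-2$; (2) for each $0\le k\le m$: $F_{k,l}\le F_{k,l+1}$ for $0\le l\le n-1$, and $F_{k,l}-F_{k,l+1}\le F_{k,l+1}-F_{k,l+2}$ for $0\le l\le n-2$.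
   Context: For non-negative integers $a,r$, $\binom{a}{r}$ is the usual binomial coefficient, with $\binom{a}{0}=1$ and $\binom{a}{r}=0$ if $r>a$. $E$ denotes expectation. The quantity $\overline{S}_{k,l}$ is defined by $$\overline{S}_{k,l}=\binom{m}{k}E\left[\binom{n-T}{l}\right]+\binom{n}{l}E\left[\binom{m-S}{k}\right]-E\left[\binom{m-S}{k}\binom{n-T}{l}\right].$$ *)

theory Defs
  imports "HOL-Probability.Probability"
begin

text \<open>Truncated subtraction in \<open>m - S \<omega>\<close> and \<open>n - T \<omega>\<close> is harmless, because
  these notions are used only where \<open>S \<le> m\<close> and \<open>T \<le> n\<close>.\<close>

definition S_bar ::
  "'a measure \<Rightarrow> nat \<Rightarrow> nat \<Rightarrow> ('a \<Rightarrow> nat) \<Rightarrow> ('a \<Rightarrow> nat) \<Rightarrow> nat \<Rightarrow> nat \<Rightarrow> real" where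
  "S_bar M m n S T k l =
     real (m choose k) * (\<integral>\<omega>. real ((n - T \<omega>) choose l) \<partial>M)
   + real (n choose l) * (\<integral>\<omega>. real ((m - S \<omega>) choose k) \<partial>M)
   - (\<integral>\<omega>. real ((m - S \<omega>) choose k) * real ((n - T \<omega>) choose l) \<partial>M)"

definition frechet_lower ::
  "'a measure \<Rightarrow> nat \<Rightarrow> nat \<Rightarrow> ('a \<Rightarrow> nat) \<Rightarrow> ('a \<Rightarrow> nat) \<Rightarrow> nat \<Rightarrow> nat \<Rightarrow> real" where
  "frechet_lower M m n S T k l =
     (real (m choose k) * real (n choose l) - S_bar M m n S T k l)
     / (real (m choose k) * real (n choose l))"

end

theory Submission
  imports Defs
begin

text \<open>Put \<open>g N s k = 1 - (N - s choose k) / (N choose k)\<close>. Expanding the product gives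
  \<open>F k l = E (g m S k * g n T l)\<close>. Since \<open>g\<close> is nonnegative, and nondecreasing and concave in
  \<open>k\<close>, the claims hold pointwise under the expectation.\<close>

text \<open>For \<open>s \<le> N\<close> and \<open>k \<le> N\<close> this is the probability that a
  uniformly random \<open>k\<close>-subset of an \<open>N\<close>-set misses a fixed
  \<open>s\<close>-subset.\<close>

definition miss_ratio :: "nat \<Rightarrow> nat \<Rightarrow> nat \<Rightarrow> real" where
  "miss_ratio N s k = real ((N - s) choose k) / real (N choose k)"

text \<open>With real subtraction the absorption identity needs no bound on \<open>k\<close>: if
  \<open>k > a\<close>, both binomials vanish, so the negative factor does no harm.\<close>

lemma Suc_times_binomial_Suc_real:
  "real (Suc k) * real (a choose Suc k) = (real a - real k) * real (a choose k)"
proof (cases "k \<le> a")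
  case True
  have "Suc k * (a choose Suc k) = (a - k) * (a choose k)"
    by (metis binomial_absorb_comp binomial_absorption diff_Suc_1)
  then have "real (Suc k * (a choose Suc k)) = real ((a - k) * (a choose k))"
    by (rule arg_cong)
  then show ?thesis
    using True by (simp only: of_nat_mult of_nat_diff)
next
  case False
  then show ?thesis by (simp add: binomial_eq_0)
qed

lemma miss_ratio_nonneg: "0 \<le> miss_ratio N s k"
  by (simp add: miss_ratio_def)

lemma miss_ratio_le_1: "k \<le> N \<Longrightarrow> miss_ratio N s k \<le> 1"
  by (simp add: miss_ratio_def binomial_right_mono)

text \<open>Drawing without replacement, once \<open>k\<close> draws have missed the
  \<open>s\<close> marked elements, the next one misses with probability
  \<open>(N - s - k) / (N - k)\<close>. If \<open>k > N - s\<close> this factor is negative, but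
  then \<open>miss_ratio N s k = 0\<close>.\<close>

lemma miss_ratio_Suc:
  assumes "s \<le> N" "k < N"
  shows "miss_ratio N s (Suc k)
    = miss_ratio N s k * (real N - real s - real k) / (real N - real k)"
proof -
  have "real (Suc k) * real ((N - s) choose Suc k)
      = (real N - real s - real k) * real ((N - s) choose k)"
    using Suc_times_binomial_Suc_real[of k "N - s"] assms by simp
  moreover have "real (Suc k) * real (N choose Suc k) = (real N - real k) * real (N choose k)"
    by (rule Suc_times_binomial_Suc_real)
  moreover have "miss_ratio N s (Suc k)
      = (real (Suc k) * real ((N - s) choose Suc k)) / (real (Suc k) * real (N choose Suc k))"
    unfolding miss_ratio_def by (rule mult_divide_mult_cancel_left[symmetric]) simp
  ultimately show ?thesis
    by (simp add: miss_ratio_def mult.commute)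
qed

lemma miss_ratio_diff:
  assumes "s \<le> N" "k < N"
  shows "miss_ratio N s k - miss_ratio N s (Suc k) = miss_ratio N s k * real s / (real N - real k)"
  using assms by (simp add: miss_ratio_Suc field_simps)

lemma miss_ratio_decreasing:
  assumes "s \<le> N" "k < N"
  shows "miss_ratio N s (Suc k) \<le> miss_ratio N s k"
proof -
  have "0 \<le> miss_ratio N s k * real s / (real N - real k)"
    using assms by (simp add: miss_ratio_nonneg)
  then show ?thesis
    using miss_ratio_diff[OF assms] by linarith
qed

text \<open>By \<open>miss_ratio_diff\<close> and \<open>miss_ratio_Suc\<close>, passing from
  \<open>k\<close> to \<open>k + 1\<close> multiplies the decrement by
  \<open>(N - s - k) / (N - k - 1)\<close>. This is at most 1 exactly when \<open>s \<ge> 1\<close>;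
  for \<open>s = 0\<close> the ratio is constantly 1 on the range considered and all decrements
  vanish.\<close>

lemma miss_ratio_convex:
  assumes "s \<le> N" "Suc k < N"
  shows "miss_ratio N s (Suc k) - miss_ratio N s (Suc (Suc k))
    \<le> miss_ratio N s k - miss_ratio N s (Suc k)"
proof (cases "s = 0")
  case True
  then show ?thesis using assms by (simp add: miss_ratio_def)
next
  case False
  define r where "r = miss_ratio N s k * real s / (real N - real k)"
  have "0 \<le> r"
    using assms by (simp add: r_def miss_ratio_nonneg)
  have "miss_ratio N s (Suc k) - miss_ratio N s (Suc (Suc k))
      = r * ((real N - real s - real k) / (real N - real k - 1))"
    using assms miss_ratio_diff[of s N "Suc k"] miss_ratio_Suc[of s N k]
    by (simp add: r_def algebra_simps)
  also have "\<dots> \<le> r * 1"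
    using assms False \<open>0 \<le> r\<close> by (intro mult_left_mono) (auto simp: divide_simps)
  finally show ?thesis
    using assms by (simp add: miss_ratio_diff r_def)
qed

text \<open>Every \<open>f\<close> is measurable on a count space, and a function with finitely many
  values is bounded, hence integrable for a probability measure.\<close>

lemma (in prob_space) integrable_finite_range:
  fixes f :: "'b \<Rightarrow> real"
  assumes "X \<in> measurable M (count_space A)" "finite A"
  shows "integrable M (\<lambda>\<omega>. f (X \<omega>))"
proof (rule integrable_const_bound)
  show "(\<lambda>\<omega>. f (X \<omega>)) \<in> borel_measurable M"
    using assms(1) by (rule measurable_compose) simp
  have "X \<omega> \<in> A" if "\<omega> \<in> space M" for \<omega>
    using measurable_space[OF assms(1) that] by simp
  \<comment> \<open>The sum of all norms is a crude bound that spares a maximum over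
    \<open>A\<close>.\<close>
  then show "AE \<omega> in M. norm (f (X \<omega>)) \<le> (\<Sum>a\<in>A. norm (f a))"
    using assms(2) by (intro AE_I2 member_le_sum[where f = "\<lambda>a. norm (f a)"]) auto
qed

lemma (in prob_space) frechet_lower_eq_expectation:
  assumes X: "(\<lambda>\<omega>. (S \<omega>, T \<omega>)) \<in> measurable M (count_space ({0..m} \<times> {0..n}))"
    and "k \<le> m" "l \<le> n"
  shows "frechet_lower M m n S T k l
    = expectation (\<lambda>\<omega>. (1 - miss_ratio m (S \<omega>) k) * (1 - miss_ratio n (T \<omega>) l))"
proof -
  note int = integrable_finite_range[OF X]
  \<comment> \<open>The bounds on \<open>k\<close> and \<open>l\<close> enter here: they keep the
    denominators nonzero, so that the final division can be carried out.\<close>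
  have pos: "real (m choose k) \<noteq> 0" "real (n choose l) \<noteq> 0"
    using assms by auto
  \<comment> \<open>Only the pair is assumed measurable, so functions of \<open>S\<close> or
    \<open>T\<close> alone are treated as functions of the pair.\<close>
  have i1: "integrable M (\<lambda>\<omega>. miss_ratio m (S \<omega>) k)"
    using int[of "\<lambda>(s, t). miss_ratio m s k"] by simp
  have i2: "integrable M (\<lambda>\<omega>. miss_ratio n (T \<omega>) l)"
    using int[of "\<lambda>(s, t). miss_ratio n t l"] by simp
  have i3: "integrable M (\<lambda>\<omega>. miss_ratio m (S \<omega>) k * miss_ratio n (T \<omega>) l)"
    using int[of "\<lambda>(s, t). miss_ratio m s k * miss_ratio n t l"] by simp
  have "expectation (\<lambda>\<omega>. (1 - miss_ratio m (S \<omega>) k) * (1 - miss_ratio n (T \<omega>) l))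
      = expectation (\<lambda>\<omega>. 1 - miss_ratio m (S \<omega>) k - miss_ratio n (T \<omega>) l
          + miss_ratio m (S \<omega>) k * miss_ratio n (T \<omega>) l)"
    by (simp add: algebra_simps)
  also have "\<dots> = 1 - expectation (\<lambda>\<omega>. miss_ratio m (S \<omega>) k)
      - expectation (\<lambda>\<omega>. miss_ratio n (T \<omega>) l)
      + expectation (\<lambda>\<omega>. miss_ratio m (S \<omega>) k * miss_ratio n (T \<omega>) l)"
    using i1 i2 i3 by (simp add: prob_space)
  also have "\<dots> = frechet_lower M m n S T k l"
    using pos by (simp add: frechet_lower_def S_bar_def miss_ratio_def field_simps)
  finally show ?thesis by simp
qed

theorem mainTheorem5:
  fixes M :: "'a measure" and S T :: "'a \<Rightarrow> nat" and m n :: nat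
  defines "F \<equiv> frechet_lower M m n S T"
  assumes "prob_space M"
    and "m > 0" and "n > 0"
    and "(\<lambda>\<omega>. (S \<omega>, T \<omega>)) \<in> measurable M (count_space ({0..m} \<times> {0..n}))"
  shows "(\<forall>l\<le>n. (\<forall>k. k + 1 \<le> m \<longrightarrow> F k l \<le> F (k + 1) l) \<and>
                 (\<forall>k. k + 2 \<le> m \<longrightarrow> F k l - F (k + 1) l \<le> F (k + 1) l - F (k + 2) l)) \<and>
         (\<forall>k\<le>m. (\<forall>l. l + 1 \<le> n \<longrightarrow> F k l \<le> F k (l + 1)) \<and>
                 (\<forall>l. l + 2 \<le> n \<longrightarrow> F k l - F k (l + 1) \<le> F k (l + 1) - F k (l + 2)))"
proof -
  interpret prob_space M by fact
  note X = assms(5)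
  define g where "g N s k = 1 - miss_ratio N s k" for N s k
  define h where "h k l = (\<lambda>\<omega>. g m (S \<omega>) k * g n (T \<omega>) l)" for k l
  have F: "F k l = expectation (h k l)" if "k \<le> m" "l \<le> n" for k l
    using frechet_lower_eq_expectation[OF X that] by (simp add: F_def h_def g_def)
  have int: "integrable M (h k l)" for k l
    using integrable_finite_range[OF X, of "\<lambda>(s, t). g m s k * g n t l"] by (simp add: h_def)
  \<comment> \<open>The bounds hold at every point of the space, so the inequalities below can be
    proved pointwise.\<close>
  have rng: "S \<omega> \<le> m" "T \<omega> \<le> n" if "\<omega> \<in> space M" for \<omega>
    using measurable_space[OF X that] by auto
  have g0: "0 \<le> g N s k" if "k \<le> N" for N s k
    using miss_ratio_le_1[OF that] by (simp add: g_def)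
  have g1: "g N s k \<le> g N s (k + 1)" if "s \<le> N" "k + 1 \<le> N" for N s k
    using miss_ratio_decreasing[of s N k] that by (simp add: g_def)
  \<comment> \<open>Concavity is put in additive form, ready to be multiplied by a nonnegative
    factor.\<close>
  have g2: "g N s k + g N s (k + 2) \<le> 2 * g N s (k + 1)" if "s \<le> N" "k + 2 \<le> N" for N s k
    using miss_ratio_convex[of s N k] that by (simp add: g_def)
  have mono: "expectation (h k l) \<le> expectation (h k' l')"
    if "\<And>\<omega>. \<omega> \<in> space M \<Longrightarrow> h k l \<omega> \<le> h k' l' \<omega>" for k l k' l'
    using int int that by (rule integral_mono)
  \<comment> \<open>All six indices are free, so one statement serves concavity in \<open>k\<close>
    and in \<open>l\<close>.\<close>
  have conc: "expectation (h a b) - expectation (h a' b')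
      \<le> expectation (h a' b') - expectation (h a'' b'')"
    if "\<And>\<omega>. \<omega> \<in> space M \<Longrightarrow> h a b \<omega> + h a'' b'' \<omega> \<le> 2 * h a' b' \<omega>" for a b a' b' a'' b''
  proof -
    have "expectation (\<lambda>\<omega>. h a b \<omega> + h a'' b'' \<omega>) \<le> expectation (\<lambda>\<omega>. 2 * h a' b' \<omega>)"
      by (intro integral_mono that) (simp_all add: int)
    then show ?thesis
      by (simp add: int)
  qed
  have "F k l \<le> F (k + 1) l" if "l \<le> n" "k + 1 \<le> m" for k l
  proof -
    have "h k l \<omega> \<le> h (k + 1) l \<omega>" if "\<omega> \<in> space M" for \<omega>
      unfolding h_def using rng[OF that] \<open>l \<le> n\<close> \<open>k + 1 \<le> m\<close>
      by (intro mult_right_mono g1 g0)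
    then show ?thesis using that mono by (simp add: F)
  qed
  moreover have "F k l \<le> F k (l + 1)" if "k \<le> m" "l + 1 \<le> n" for k l
  proof -
    have "h k l \<omega> \<le> h k (l + 1) \<omega>" if "\<omega> \<in> space M" for \<omega>
      unfolding h_def using rng[OF that] \<open>k \<le> m\<close> \<open>l + 1 \<le> n\<close>
      by (intro mult_left_mono g1 g0)
    then show ?thesis using that mono by (simp add: F)
  qed
  moreover have "F k l - F (k + 1) l \<le> F (k + 1) l - F (k + 2) l" if "l \<le> n" "k + 2 \<le> m" for k l
  proof -
    \<comment> \<open>The factor \<open>g n (T \<omega>) l\<close> does not depend on
      \<open>k\<close> and is nonnegative, so multiplying \<open>g2\<close> by it keeps the
      inequality.\<close>
    have "h k l \<omega> + h (k + 2) l \<omega> \<le> 2 * h (k + 1) l \<omega>" if "\<omega> \<in> space M" for \<omega>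
      using mult_right_mono[OF g2[OF rng(1)[OF that] \<open>k + 2 \<le> m\<close>] g0[OF \<open>l \<le> n\<close>, of "T \<omega>"]]
      by (simp add: h_def algebra_simps)
    from conc[OF this] show ?thesis using that by (simp add: F)
  qed
  moreover have "F k l - F k (l + 1) \<le> F k (l + 1) - F k (l + 2)" if "k \<le> m" "l + 2 \<le> n" for k l
  proof -
    have "h k l \<omega> + h k (l + 2) \<omega> \<le> 2 * h k (l + 1) \<omega>" if "\<omega> \<in> space M" for \<omega>
      using mult_left_mono[OF g2[OF rng(2)[OF that] \<open>l + 2 \<le> n\<close>] g0[OF \<open>k \<le> m\<close>, of "S \<omega>"]]
      by (simp add: h_def algebra_simps)
    from conc[OF this] show ?thesis using that by (simp add: F)
  qed
  ultimately show ?thesis by blast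
qed

end
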